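(* Let $\mathcal L=\sum_{\boldsymbol m\in\mathcal M(c)}a_{\boldsymbol m}\partial^{\boldsymbol m}$ be a constant-coefficient linear partial differential operator of order $c$ with only terms of equal order (i.e. $a_{\boldsymbol m}=0$ unless $|\boldsymbol m|=c$), and let $G$ satisfy $\mathcal LG=0$ on $\mathbb R^d\setminus\{\boldsymbol 0\}$. Let $\boldsymbol y,\boldsymbol c_1,\boldsymbol c_2\in\mathbb R^d$ and $\boldsymbol h=\boldsymbol c_2-\boldsymbol c_1$. Let $\boldsymbol\beta$ be the coefficients, in compressed representation, of the order-$p$ multipole expansion of the source $\boldsymbol y$ around the center $\boldsymbol c_1$ (defined in the context), and for $n\in\{1,\dots,N(p)\}$ let $$\boldsymbol\rho_n=\frac{(\boldsymbol c_2-\boldsymbol y)^{\boldsymbol\nu(n)}}{\boldsymbol\nu(n)!},\qquad \boldsymbol\sigma_n=\sum_{i\in\{1,\dots,N(p)\},\ \boldsymbol\nu(i)\le\boldsymbol\nu(n)}\frac{\boldsymbol h^{\boldsymbol\nu(n)-\boldsymbol\nu(i)}}{(\boldsymbol\nu(n)-\boldsymbol\nu(i))!}[E\boldsymbol\beta]_i .$$ Then for every $\boldsymbol x\in\mathbb R^d$ with $\boldsymbol x\ne\boldsymbol c_2$, $$\sum_{n=1}^{N(p)}\boldsymbol\sigma_n\,(\partial^{\boldsymbol\nu(n)}G)(\boldsymbol x-\boldsymbol c_2)=\sum_{n=1}^{N(p)}\boldsymbol\rho_n\,(\partial^{\boldsymbol\nu(n)}G)(\boldsymbol x-\boldsymbol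 c_2).$$
   Context: Notation. $d\ge1$; for $\boldsymbol q\in\mathbb N_0^d$, $|\boldsymbol q|=\sum_i q_i$, $\boldsymbol q!=\prod_i q_i!$, $\boldsymbol x^{\boldsymbol q}=\prod_i x_i^{q_i}$, $\partial^{\boldsymbol q}=\prod_i\partial_{x_i}^{q_i}$, and $\boldsymbol m\ge\boldsymbol n$, $\boldsymbol n\le\boldsymbol m$ are meant componentwise. $\mathcal M(p)=\{\boldsymbol q\in\mathbb N_0^d:|\boldsymbol q|\le p\}$, $N(p)=|\mathcal M(p)|$. $\mathcal L$ has order $c\ge1$ ($a_{\boldsymbol m}\in\mathbb C$, $a_{\boldsymbol m}\ne0$ for some $|\boldsymbol m|=c$), $p\ge c$, and $G:\mathbb R^d\setminus\{\boldsymbol 0\}\to\mathbb C$ is of class $C^{2p}$. Graded monomial ordering: a bijection $\boldsymbol\nu:\mathbb N=\{1,2,\dots\}\to\mathbb N_0^d$ with $\boldsymbol\nu(1)=\boldsymbol 0$; $|\boldsymbol\nu(i)|<|\boldsymbol\nu(j)|\Rightarrow i<j$; and $i<j\Rightarrow\boldsymbol\nu^{-1}(\boldsymbol\nu(i)+\boldsymbol\nu(k))<\boldsymbol\nu^{-1}(\boldsymbol\nu(j)+\boldsymbol\nu(k))$ for all $i,j,k$. Fix one. Compression. Let $P\in\mathbb C^{N(p-c)\times N(p)}$, $P_{i_1,i_2}=b_{\boldsymbol\nu(i_1),\boldsymbol\nu(i_2)}$, where $b_{\boldsymbol n,\boldsymbol m}=a_{\boldsymbol m-\boldsymbol n}$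 if $\boldsymbol m\ge\boldsymbol n$ and $\boldsymbol m-\boldsymbol n\in\mathcal M(c)$, and $0$ otherwise. Let $h(i)$ be the index of the last nonzero column in row $i$ of $P$, $\bar{\boldsymbol j}=\{h(1),\dots,h(N(p-c))\}$ and $\boldsymbol j=\{1,\dots,N(p)\}\setminus\bar{\boldsymbol j}$. The submatrix $P_{[:,\bar{\boldsymbol j}]}$ of the columns $\bar{\boldsymbol j}$ is square and invertible. The decompression matrix $M$, with $N(p)$ rows and columns indexed by $\boldsymbol j$, has $M_{[\boldsymbol j,:]}=I$ and $M_{[\bar{\boldsymbol j},:]}=-P_{[:,\bar{\boldsymbol j}]}^{-1}P_{[:,\boldsymbol j]}$. The order-$p$ multipole expansion of the source $\boldsymbol y$ around $\boldsymbol c_1$ has uncompressed coefficients $\boldsymbol\alpha_i=(\boldsymbol c_1-\boldsymbol y)^{\boldsymbol\nu(i)}/\boldsymbol\nu(i)!$, $1\le i\le N(p)$, and compressed coefficients $\boldsymbol\beta=M^T\boldsymbol\alpha=(\boldsymbol\beta_i)_{i\in\boldsymbol j}$. The embedding $E$ is defined by $[E\boldsymbol\beta]_i=\boldsymbol\beta_i$ for $i\in\boldsymbol j$ and $[E\boldsymbol\beta]_i=0$ for $i\in\{1,\dots,N(p)\}\setminus\boldsymbol j$. *)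

theory Defs
  imports "HOL-Analysis.Analysis"
begin

type_synonym 'n multi_index = "nat ^ 'n"

definition mi_degree :: "('n::finite) multi_index \<Rightarrow> nat" where
  "mi_degree q = (\<Sum>i\<in>UNIV. q $ i)"

definition mi_fact :: "('n::finite) multi_index \<Rightarrow> real" where
  "mi_fact q = (\<Prod>i\<in>UNIV. fact (q $ i))"

definition mi_power :: "real ^ 'n \<Rightarrow> ('n::finite) multi_index \<Rightarrow> real" where
  "mi_power x q = (\<Prod>i\<in>UNIV. (x $ i) ^ (q $ i))"

definition mi_upto :: "nat \<Rightarrow> ('n::finite) multi_index set" where
  "mi_upto p = {q. mi_degree q \<le> p}"

definition mi_count :: "('n::finite) itself \<Rightarrow> nat \<Rightarrow> nat" where
  "mi_count _ p = card (mi_upto p :: 'n multi_index set)"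


definition pderivative :: "'n::finite \<Rightarrow> (real ^ 'n \<Rightarrow> complex) \<Rightarrow> real ^ 'n \<Rightarrow> complex" where
  "pderivative i f x = vector_derivative (\<lambda>t. f (x + t *\<^sub>R axis i 1)) (at 0)"

(* Class C^k on S; meant for open S. *)
primrec C_class :: "nat \<Rightarrow> (real ^ 'n) set \<Rightarrow> (real ^ 'n::finite \<Rightarrow> complex) \<Rightarrow> bool" where
  "C_class 0 S f \<longleftrightarrow> continuous_on S f"
| "C_class (Suc k) S f \<longleftrightarrow> continuous_on S f \<and>
     (\<forall>i. (\<forall>x\<in>S. (\<lambda>t::real. f (x + t *\<^sub>R axis i 1)) differentiable (at 0)) \<and>
          C_class k S (pderivative i f))"

(* The index type carries no canonical order, so the coordinates are listed in one arbitrarily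
   chosen order. For functions of class C^k and |q| <= k the choice is immaterial, because
   partial derivatives commute. *)
definition coord_list :: "'n::finite list" where
  "coord_list = (SOME is. distinct is \<and> set is = UNIV)"

definition mi_deriv :: "('n::finite) multi_index \<Rightarrow> (real ^ 'n \<Rightarrow> complex) \<Rightarrow> real ^ 'n \<Rightarrow> complex" where
  "mi_deriv q f = foldr (\<lambda>i g. (pderivative i ^^ (q $ i)) g) coord_list f"

(* Here a gives the coefficients of the operator; only its values on mi_upto c matter. *)
definition has_order :: "(('n::finite) multi_index \<Rightarrow> complex) \<Rightarrow> nat \<Rightarrow> bool" where
  "has_order a c \<longleftrightarrow> (\<exists>m. mi_degree m = c \<and> a m \<noteq> 0)"

definition diff_op :: "(('n::finite) multi_index \<Rightarrow> complex) \<Rightarrow> nat \<Rightarrow>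
    (real ^ 'n \<Rightarrow> complex) \<Rightarrow> real ^ 'n \<Rightarrow> complex" where
  "diff_op a c f x = (\<Sum>m\<in>mi_upto c. a m * mi_deriv m f x)"


(* The ordering is a bijection from the positive integers; its value at 0 is irrelevant. *)
definition mi_index :: "(nat \<Rightarrow> ('n::finite) multi_index) \<Rightarrow> 'n multi_index \<Rightarrow> nat" where
  "mi_index \<nu> = inv_into {1..} \<nu>"

definition graded_monomial_ordering :: "(nat \<Rightarrow> ('n::finite) multi_index) \<Rightarrow> bool" where
  "graded_monomial_ordering \<nu> \<longleftrightarrow>
     bij_betw \<nu> {1..} UNIV \<and> \<nu> 1 = 0 \<and>
     (\<forall>i\<ge>1. \<forall>j\<ge>1. mi_degree (\<nu> i) < mi_degree (\<nu> j) \<longrightarrow> i < j) \<and>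
     (\<forall>i\<ge>1. \<forall>j\<ge>1. \<forall>k\<ge>1. i < j \<longrightarrow> mi_index \<nu> (\<nu> i + \<nu> k) < mi_index \<nu> (\<nu> j + \<nu> k))"


(* Matrices are functions of a row and a column index; index sets are kept explicit. A is
   indexed by R x K and its inverse B by K x R. *)
definition is_inverse_on :: "nat set \<Rightarrow> nat set \<Rightarrow> (nat \<Rightarrow> nat \<Rightarrow> complex) \<Rightarrow>
    (nat \<Rightarrow> nat \<Rightarrow> complex) \<Rightarrow> bool" where
  "is_inverse_on R K A B \<longleftrightarrow>
     (\<forall>r\<in>R. \<forall>r'\<in>R. (\<Sum>k\<in>K. A r k * B k r') = (if r = r' then 1 else 0)) \<and>
     (\<forall>k\<in>K. \<forall>k'\<in>K. (\<Sum>r\<in>R. B k r * A r k') = (if k = k' then 1 else 0))"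

(* If A is invertible, the entries of the inverse on K x R are uniquely determined. *)
definition inverse_on :: "nat set \<Rightarrow> nat set \<Rightarrow> (nat \<Rightarrow> nat \<Rightarrow> complex) \<Rightarrow> nat \<Rightarrow> nat \<Rightarrow> complex" where
  "inverse_on R K A = (SOME B. is_inverse_on R K A B)"

definition P_mat :: "(('n::finite) multi_index \<Rightarrow> complex) \<Rightarrow> nat \<Rightarrow> (nat \<Rightarrow> 'n multi_index) \<Rightarrow>
    nat \<Rightarrow> nat \<Rightarrow> complex" where
  "P_mat a c \<nu> i k =
     (if \<nu> i \<le> \<nu> k \<and> \<nu> k - \<nu> i \<in> mi_upto c then a (\<nu> k - \<nu> i) else 0)"

definition P_rows :: "('n::finite) itself \<Rightarrow> nat \<Rightarrow> nat \<Rightarrow> nat set" where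
  "P_rows T c p = {1..mi_count T (p - c)}"

definition P_cols :: "('n::finite) itself \<Rightarrow> nat \<Rightarrow> nat set" where
  "P_cols T p = {1..mi_count T p}"

definition last_col :: "(('n::finite) multi_index \<Rightarrow> complex) \<Rightarrow> nat \<Rightarrow> nat \<Rightarrow>
    (nat \<Rightarrow> 'n multi_index) \<Rightarrow> nat \<Rightarrow> nat" where
  "last_col a c p \<nu> i = Max {k \<in> P_cols TYPE('n) p. P_mat a c \<nu> i k \<noteq> 0}"

definition J_bar :: "(('n::finite) multi_index \<Rightarrow> complex) \<Rightarrow> nat \<Rightarrow> nat \<Rightarrow>
    (nat \<Rightarrow> 'n multi_index) \<Rightarrow> nat set" where
  "J_bar a c p \<nu> = last_col a c p \<nu> ` P_rows TYPE('n) c p"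

definition J_set :: "(('n::finite) multi_index \<Rightarrow> complex) \<Rightarrow> nat \<Rightarrow> nat \<Rightarrow>
    (nat \<Rightarrow> 'n multi_index) \<Rightarrow> nat set" where
  "J_set a c p \<nu> = P_cols TYPE('n) p - J_bar a c p \<nu>"

(* Rows are indexed by P_cols, columns by J_set. *)
definition decompression :: "(('n::finite) multi_index \<Rightarrow> complex) \<Rightarrow> nat \<Rightarrow> nat \<Rightarrow>
    (nat \<Rightarrow> 'n multi_index) \<Rightarrow> nat \<Rightarrow> nat \<Rightarrow> complex" where
  "decompression a c p \<nu> k l =
     (if k \<in> J_set a c p \<nu> then (if k = l then 1 else 0)
      else - (\<Sum>r\<in>P_rows TYPE('n) c p.
                inverse_on (P_rows TYPE('n) c p) (J_bar a c p \<nu>) (P_mat a c \<nu>) k r * P_mat a c \<nu> r l))"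


definition multipole_coeff :: "(nat \<Rightarrow> ('n::finite) multi_index) \<Rightarrow> real ^ 'n \<Rightarrow> real ^ 'n \<Rightarrow>
    nat \<Rightarrow> real" where
  "multipole_coeff \<nu> y z i = mi_power (z - y) (\<nu> i) / mi_fact (\<nu> i)"

definition compressed_coeff :: "(('n::finite) multi_index \<Rightarrow> complex) \<Rightarrow> nat \<Rightarrow> nat \<Rightarrow>
    (nat \<Rightarrow> 'n multi_index) \<Rightarrow> real ^ 'n \<Rightarrow> real ^ 'n \<Rightarrow> nat \<Rightarrow> complex" where
  "compressed_coeff a c p \<nu> y z i =
     (\<Sum>k\<in>P_cols TYPE('n) p. decompression a c p \<nu> k i * of_real (multipole_coeff \<nu> y z k))"

definition embed_coeff :: "nat set \<Rightarrow> (nat \<Rightarrow> complex) \<Rightarrow> nat \<Rightarrow> complex" where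
  "embed_coeff J \<beta> i = (if i \<in> J then \<beta> i else 0)"

end

theory Submission
  imports Defs
begin

text \<open>
  Re-expanding the full coefficients \<open>\<alpha>\<^sub>i = (c1 - y)\<^sup>\<nu>\<^sup>i / \<nu>i!\<close> around \<open>c2\<close> gives exactly
  \<open>\<rho>\<close>: this is the binomial theorem for multi-indices (\<open>mi_binomial\<close>). So the claim says that
  the error \<open>\<alpha> - E\<beta>\<close> made by compression stays invisible after translation, and not only at the
  original center, where it is invisible by the construction of the compression.

  The reason is that the error lies in the row space of \<open>P\<close>
  (\<open>compression_residual_in_row_space\<close>). Let \<open>B\<close> be the inverse of the submatrix of \<open>P\<close> formed by the
  pivot columns. Then \<open>\<alpha> - E\<beta>\<close> equals \<open>w P\<close>, where the row \<open>w\<close> is \<open>B\<close> applied from the right to the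
  pivot entries of \<open>\<alpha>\<close>. The inverse exists because multiplication by the leading monomial of the
  symbol of the operator is increasing for a monomial ordering, which makes the submatrix lower
  triangular with the leading coefficient on its diagonal (\<open>P_mat_pivot_columns\<close>).

  It remains to see that each row of \<open>P\<close> is still annihilated after translation
  (\<open>translated_row_annihilated\<close>). Row \<open>r\<close> carries the operator composed with the derivative of
  order \<open>r\<close>. Translation composes it further with the Taylor polynomial of the shift by \<open>h\<close>,
  and truncation keeps the total order at most \<open>p\<close>. Since all terms of the operator have the same order
  \<open>c\<close>, the truncation keeps or discards, for each power \<open>h\<^sup>q\<close>, all the terms
  \<open>a\<^sub>m \<partial>\<^sup>r\<^sup>+\<^sup>q\<^sup>+\<^sup>m G\<close> together. What is kept is a combination of derivatives of
  the equation satisfied by \<open>G\<close>, hence zero (\<open>derivative_of_pde\<close>). For an inhomogeneous operator the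
  truncation would cut through these groups.
\<close>

section \<open>Symmetry of mixed partial derivatives\<close>

text \<open>
  The mean value theorem is applied first in \<open>s\<close> to the increment \<open>u s h - u s 0\<close> and then in \<open>t\<close>.
  The second difference is symmetric in the two variables, so exchanging them relates the two
  mixed derivatives at nearby points.
\<close>

lemma second_difference_mean_value:
  fixes u us ust :: "real \<Rightarrow> real \<Rightarrow> real"
  assumes "h > 0"
    and us: "\<And>s t. 0 \<le> s \<Longrightarrow> s \<le> h \<Longrightarrow> 0 \<le> t \<Longrightarrow> t \<le> h \<Longrightarrow>
               ((\<lambda>s. u s t) has_real_derivative us s t) (at s)"
    and ust: "\<And>s t. 0 \<le> s \<Longrightarrow> s \<le> h \<Longrightarrow> 0 \<le> t \<Longrightarrow> t \<le> h \<Longrightarrow>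
               ((\<lambda>t. us s t) has_real_derivative ust s t) (at t)"
  obtains \<xi> \<eta> where "0 < \<xi>" "\<xi> < h" "0 < \<eta>" "\<eta> < h"
    "u h h - u h 0 - u 0 h + u 0 0 = h * (h * ust \<xi> \<eta>)"
proof -
  have "\<exists>\<xi>. 0 < \<xi> \<and> \<xi> < h \<and> (u h h - u h 0) - (u 0 h - u 0 0) = (h - 0) * (us \<xi> h - us \<xi> 0)"
    using assms by (intro MVT2 DERIV_diff us) auto
  then obtain \<xi> where \<xi>: "0 < \<xi>" "\<xi> < h"
    "(u h h - u h 0) - (u 0 h - u 0 0) = h * (us \<xi> h - us \<xi> 0)"
    by auto
  have "\<exists>\<eta>. 0 < \<eta> \<and> \<eta> < h \<and> us \<xi> h - us \<xi> 0 = (h - 0) * ust \<xi> \<eta>"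
    using assms \<xi> by (intro MVT2 ust) auto
  then obtain \<eta> where "0 < \<eta>" "\<eta> < h" "us \<xi> h - us \<xi> 0 = h * ust \<xi> \<eta>"
    by auto
  with \<xi> show ?thesis by (intro that[of \<xi> \<eta>]) auto
qed

lemma C_class_continuous_on: "C_class k S f \<Longrightarrow> continuous_on S f"
  by (cases k) auto

lemma C_class_mono: "C_class (k + l) S f \<Longrightarrow> C_class k S f"
proof (induction k arbitrary: f)
  case 0
  then show ?case by (auto dest: C_class_continuous_on)
qed auto

text \<open>The definition of the class only provides derivatives at parameter \<open>0\<close> of lines based at points of
  the set; the mean value theorem needs them along the whole line.\<close>

lemma C_class_has_vector_derivative:
  assumes "C_class (Suc k) S f" and "z + s *\<^sub>R axis i 1 \<in> S"
  shows "((\<lambda>s. f (z + s *\<^sub>R axis i 1)) has_vector_derivative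
           pderivative i f (z + s *\<^sub>R axis i 1)) (at s)"
proof -
  let ?F = "\<lambda>t. f ((z + s *\<^sub>R axis i 1) + t *\<^sub>R axis i 1)"
  have "(?F has_vector_derivative pderivative i f (z + s *\<^sub>R axis i 1)) (at 0)"
    using assms unfolding pderivative_def
    by (auto simp: vector_derivative_works)
  moreover have "((\<lambda>r. r - s) has_vector_derivative 1) (at s)"
    by (auto intro!: derivative_eq_intros)
  ultimately have "((?F \<circ> (\<lambda>r. r - s)) has_vector_derivative
      1 *\<^sub>R pderivative i f (z + s *\<^sub>R axis i 1)) (at s)"
    by (intro vector_diff_chain_at) auto
  moreover have "?F \<circ> (\<lambda>r. r - s) = (\<lambda>r. f (z + r *\<^sub>R axis i 1))"
    by (auto simp: fun_eq_iff algebra_simps)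
  ultimately show ?thesis by simp
qed

text \<open>Schwarz's theorem. The mean value theorem fails for complex values, so the argument is
  run for the real and the imaginary part separately, as bounded linear functionals \<open>L\<close>.\<close>

lemma pderivative_commute:
  fixes f :: "real ^ 'n::finite \<Rightarrow> complex"
  assumes f: "C_class 2 S f" and S: "open S" "x \<in> S"
  shows "pderivative i (pderivative j f) x = pderivative j (pderivative i f) x"
proof -
  define pt where "pt s t = x + s *\<^sub>R axis i 1 + t *\<^sub>R (axis j 1 :: real ^ 'n)" for s t
  have pt': "pt s t = x + t *\<^sub>R axis j 1 + s *\<^sub>R (axis i 1 :: real ^ 'n)" for s t
    by (simp add: pt_def)
  have f1: "C_class (Suc 1) S f" and fl: "C_class (Suc 0) S (pderivative l f)"
    and cont: "continuous_on S (pderivative k (pderivative l f))" for k l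
    using f by (auto simp: numeral_2_eq_2)
  obtain d where d: "d > 0" "ball x d \<subseteq> S"
    using S open_contains_ball by blast
  have dist: "dist (pt s t) x \<le> \<bar>s\<bar> + \<bar>t\<bar>" for s t
  proof -
    have "dist (pt s t) x = norm (s *\<^sub>R axis i 1 + t *\<^sub>R (axis j 1 :: real ^ 'n))"
      by (simp add: pt_def dist_norm)
    also have "\<dots> \<le> \<bar>s\<bar> + \<bar>t\<bar>"
      by (rule order_trans[OF norm_triangle_ineq]) simp
    finally show ?thesis .
  qed
  have close: "L (pderivative i (pderivative j f) x) = L (pderivative j (pderivative i f) x)"
    if L: "bounded_linear L" for L :: "complex \<Rightarrow> real"
  proof (rule ccontr)
    let ?u = "\<lambda>s t. L (f (pt s t))"
    let ?ji = "\<lambda>z. L (pderivative j (pderivative i f) z)"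
    let ?ij = "\<lambda>z. L (pderivative i (pderivative j f) z)"
    \<comment> \<open>If the two values differed by \<open>2 e\<close>, continuity would keep the mixed derivatives apart on a
      small square, while the second difference forces them to agree at two points of it.\<close>
    assume ne: "?ij x \<noteq> ?ji x"
    define e where "e = \<bar>?ij x - ?ji x\<bar> / 2"
    have e: "e > 0" using ne by (simp add: e_def)
    have "isCont ?ij x" "isCont ?ji x"
      using cont S by (auto intro!: bounded_linear.isCont[OF L] simp: continuous_on_eq_continuous_at)
    with e obtain d1 d2 where d12: "d1 > 0" "d2 > 0"
      "\<And>z. dist z x < d1 \<Longrightarrow> \<bar>?ij z - ?ij x\<bar> < e"
      "\<And>z. dist z x < d2 \<Longrightarrow> \<bar>?ji z - ?ji x\<bar> < e"
      unfolding continuous_at_eps_delta dist_real_def by metis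
    define h where "h = Min {d, d1, d2} / 3"
    have h: "h > 0" "2 * h < d" "2 * h < d1" "2 * h < d2"
      using d d12 by (auto simp: h_def min_def)
    have inS: "pt s t \<in> S" if "0 \<le> s" "s \<le> h" "0 \<le> t" "t \<le> h" for s t
      using that h d dist[of s t] by (auto simp: subset_iff dist_commute)
    have der_s: "((\<lambda>s. L (g (pt s t))) has_real_derivative L (pderivative i g (pt s t))) (at s)"
      if "C_class (Suc k) S g" "pt s t \<in> S" for g s t k
      unfolding has_real_derivative_iff_has_vector_derivative pt'
      using that unfolding pt'
      by (intro bounded_linear.has_vector_derivative[OF L] C_class_has_vector_derivative)
    have der_t: "((\<lambda>t. L (g (pt s t))) has_real_derivative L (pderivative j g (pt s t))) (at t)"
      if "C_class (Suc k) S g" "pt s t \<in> S" for g s t k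
      unfolding has_real_derivative_iff_has_vector_derivative pt_def
      using that unfolding pt_def
      by (intro bounded_linear.has_vector_derivative[OF L] C_class_has_vector_derivative)
    obtain s1 t1 where 1: "0 < s1" "s1 < h" "0 < t1" "t1 < h"
      "?u h h - ?u h 0 - ?u 0 h + ?u 0 0 = h * (h * ?ji (pt s1 t1))"
      by (rule second_difference_mean_value[OF h(1), where u = ?u,
            OF der_s[OF f1 inS] der_t[OF fl inS]])
    obtain t2 s2 where 2: "0 < s2" "s2 < h" "0 < t2" "t2 < h"
      "?u h h - ?u 0 h - ?u h 0 + ?u 0 0 = h * (h * ?ij (pt s2 t2))"
      by (rule second_difference_mean_value[OF h(1), where u = "\<lambda>t s. ?u s t",
            OF der_t[OF f1 inS] der_s[OF fl inS]])
    have "h * (h * ?ji (pt s1 t1)) = h * (h * ?ij (pt s2 t2))"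
      using 1(5) 2(5) by linarith
    then have "?ji (pt s1 t1) = ?ij (pt s2 t2)"
      using h(1) by simp
    moreover have "\<bar>?ji (pt s1 t1) - ?ji x\<bar> < e" "\<bar>?ij (pt s2 t2) - ?ij x\<bar> < e"
      using 1 2 h dist[of s1 t1] dist[of s2 t2] by (auto intro!: d12)
    ultimately have "\<bar>?ij x - ?ji x\<bar> < 2 * e" by linarith
    then show False by (simp add: e_def)
  qed
  show ?thesis
    using close[OF bounded_linear_Re] close[OF bounded_linear_Im] by (rule complex_eqI)
qed

lemma pderivative_cong_on_open:
  assumes "open S" "x \<in> S" and eq: "\<And>z. z \<in> S \<Longrightarrow> f z = g z"
  shows "pderivative i f x = pderivative i g x"
proof -
  have "open ((\<lambda>t::real. x + t *\<^sub>R axis i 1) -` S)"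
    by (intro open_vimage assms continuous_intros)
  then have "\<forall>\<^sub>F t in nhds 0. x + t *\<^sub>R axis i 1 \<in> S"
    using assms(2) by (auto simp: eventually_nhds)
  then have "\<forall>\<^sub>F t in nhds 0. f (x + t *\<^sub>R axis i 1) = g (x + t *\<^sub>R axis i 1)"
    by (rule eventually_mono) (rule eq)
  then show ?thesis
    unfolding pderivative_def by (intro vector_derivative_cong_eq) (auto simp: eventually_at_filter elim: eventually_mono)
qed

section \<open>Iterated partial derivatives\<close>

text \<open>
  Indexing by words rather than multi-indices makes the order of differentiation explicit, so that
  independence of that order can be stated.
\<close>

definition pderivs :: "'n::finite list \<Rightarrow> (real ^ 'n \<Rightarrow> complex) \<Rightarrow> real ^ 'n \<Rightarrow> complex" where
  "pderivs is f = foldr pderivative is f"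

lemma pderivs_simps [simp]:
  "pderivs [] f = f"
  "pderivs (i # is) f = pderivative i (pderivs is f)"
  "pderivs (is @ js) f = pderivs is (pderivs js f)"
  by (simp_all add: pderivs_def)

lemma C_class_pderivs: "C_class (k + length is) S f \<Longrightarrow> C_class k S (pderivs is f)"
  by (induction "is" arbitrary: k) (auto, metis C_class.simps(2) add_Suc_right add_Suc)

lemma pderivs_move_to_front:
  assumes "open S" "x \<in> S" and "C_class (Suc (length is + length js)) S f"
  shows "pderivs (is @ i # js) f x = pderivs (i # is @ js) f x"
  using assms(2,3)
proof (induction "is" arbitrary: x)
  case (Cons k ks)
  have "C_class (Suc (length ks + length js)) S f"
    using Cons.prems(2) C_class_mono[of "Suc (length ks + length js)" 1 S f] by simp
  then have "pderivative k (pderivs (ks @ i # js) f) x = pderivative k (pderivs (i # ks @ js) f) x"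
    using Cons by (intro pderivative_cong_on_open[OF assms(1)]) auto
  also have "\<dots> = pderivative i (pderivative k (pderivs (ks @ js) f)) x"
    using Cons.prems assms(1)
      C_class_pderivs[of 2 "ks @ js" S f]
    by (auto intro!: pderivative_commute)
  finally show ?case by simp
qed simp

lemma pderivs_permute:
  assumes "open S" "x \<in> S" "mset is = mset js" "C_class (length is) S f"
  shows "pderivs is f x = pderivs js f x"
  using assms(2-4)
proof (induction "is" arbitrary: js x)
  case (Cons i "is")
  have "i \<in> set js"
    using Cons.prems(2) by (metis list.set_intros(1) set_mset_mset)
  then obtain us vs where js: "js = us @ i # vs"
    by (auto dest: split_list)
  have mset: "mset is = mset (us @ vs)" using Cons.prems(2) js by simp
  then have len: "length is = length us + length vs"
    by (metis length_append size_mset)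
  have "C_class (length is) S f"
    using Cons.prems(3) C_class_mono[of "length is" 1 S f] by simp
  then have "pderivative i (pderivs is f) x = pderivative i (pderivs (us @ vs) f) x"
    using mset by (intro pderivative_cong_on_open[OF assms(1)] Cons) (auto intro: Cons)
  also have "\<dots> = pderivs js f x"
    using pderivs_move_to_front[OF assms(1) Cons.prems(1), of us vs f i] Cons.prems(3) len js
    by simp
  finally show ?case by simp
qed simp

definition coord_word :: "'n::finite multi_index \<Rightarrow> 'n list" where
  "coord_word q = concat (map (\<lambda>i. replicate (q $ i) i) coord_list)"

lemma coord_list: "distinct (coord_list :: 'n::finite list)" "set (coord_list :: 'n list) = UNIV"
proof -
  have "\<exists>is :: 'n list. distinct is \<and> set is = UNIV"
    using finite_distinct_list[OF finite_class.finite_UNIV] by blast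
  then show "distinct (coord_list :: 'n list)" "set (coord_list :: 'n list) = UNIV"
    unfolding coord_list_def by (metis (mono_tags, lifting) someI_ex)+
qed

lemma mi_deriv_eq_pderivs: "mi_deriv q f = pderivs (coord_word q) f"
proof -
  have rep: "pderivs (replicate m i) g = (pderivative i ^^ m) g" for m i g
    by (induction m) auto
  have "pderivs (concat (map (\<lambda>i. replicate (q $ i) i) is)) f =
      foldr (\<lambda>i g. (pderivative i ^^ (q $ i)) g) is f" for "is"
    by (induction "is") (auto simp: rep)
  then show ?thesis by (simp add: mi_deriv_def coord_word_def)
qed

lemma count_coord_word: "count (mset (coord_word q)) i = q $ i"
proof -
  have "count (mset (concat (map (\<lambda>i. replicate (q $ i) i) is))) i =
      (if i \<in> set is then q $ i else 0)" if "distinct is" for "is"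
    using that by (induction "is") auto
  from this[OF coord_list(1)] show ?thesis
    by (simp add: coord_word_def coord_list)
qed

lemma length_coord_word: "length (coord_word q) = mi_degree q"
proof -
  have "length (coord_word q) = (\<Sum>i\<leftarrow>coord_list. q $ i)"
    by (simp add: coord_word_def length_concat comp_def)
  also have "\<dots> = mi_degree q"
    by (simp add: mi_degree_def sum_list_distinct_conv_sum_set coord_list)
  finally show ?thesis .
qed

lemma mi_degree_add: "mi_degree (q + r) = mi_degree q + mi_degree r"
  by (simp add: mi_degree_def sum.distrib)

text \<open>The word of \<open>q + r\<close> interleaves those of \<open>q\<close> and \<open>r\<close>, so this is where the symmetry of mixed
  derivatives is used.\<close>

lemma mi_deriv_add:
  assumes "open S" "x \<in> S" "C_class (mi_degree q + mi_degree r) S f"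
  shows "mi_deriv (q + r) f x = pderivs (coord_word q) (mi_deriv r f) x"
proof -
  have "mset (coord_word (q + r)) = mset (coord_word q @ coord_word r)"
    by (rule multiset_eqI) (simp add: count_coord_word)
  then show ?thesis
    using pderivs_permute[OF assms(1,2), of "coord_word (q + r)" "coord_word q @ coord_word r" f]
      assms(3) by (simp add: mi_deriv_eq_pderivs length_coord_word mi_degree_add)
qed

lemma pderivative_linear_combination:
  assumes "\<And>m. m \<in> A \<Longrightarrow> C_class 1 S (F m)" "x \<in> S"
  shows "pderivative i (\<lambda>z. \<Sum>m\<in>A. a m * F m z) x = (\<Sum>m\<in>A. a m * pderivative i (F m) x)"
proof -
  have "((\<lambda>t. F m (x + t *\<^sub>R axis i 1)) has_vector_derivative pderivative i (F m) x) (at 0)"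
    if "m \<in> A" for m
    using C_class_has_vector_derivative[of 0 S "F m" x 0 i] assms(1)[OF that] assms(2) by simp
  then have "((\<lambda>t. \<Sum>m\<in>A. a m * F m (x + t *\<^sub>R axis i 1)) has_vector_derivative
      (\<Sum>m\<in>A. a m * pderivative i (F m) x)) (at 0)"
    by (intro has_vector_derivative_sum has_vector_derivative_mult_right)
  then show ?thesis
    unfolding pderivative_def by (rule vector_derivative_at)
qed

lemma pderivs_linear_combination:
  assumes "open S" "\<And>m. m \<in> A \<Longrightarrow> C_class (length is) S (F m)" "x \<in> S"
  shows "pderivs is (\<lambda>z. \<Sum>m\<in>A. a m * F m z) x = (\<Sum>m\<in>A. a m * pderivs is (F m) x)"
  using assms(2,3)
proof (induction "is" arbitrary: x)
  case (Cons i "is")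
  have C: "C_class (length is) S (F m)" if "m \<in> A" for m
    using Cons.prems(1)[OF that] C_class_mono[of "length is" 1 S "F m"] by simp
  have C1: "C_class 1 S (pderivs is (F m))" if "m \<in> A" for m
    using Cons.prems(1)[OF that] C_class_pderivs[of 1 "is" S "F m"] by simp
  have "pderivative i (pderivs is (\<lambda>z. \<Sum>m\<in>A. a m * F m z)) x =
      pderivative i (\<lambda>z. \<Sum>m\<in>A. a m * pderivs is (F m) z) x"
    by (intro pderivative_cong_on_open[OF assms(1)] Cons.IH Cons.prems C)
  also have "\<dots> = (\<Sum>m\<in>A. a m * pderivative i (pderivs is (F m)) x)"
    by (intro pderivative_linear_combination[OF C1] Cons.prems)
  finally show ?case by simp
qed simp

lemma pderivs_zero:
  assumes "open S" "x \<in> S" "\<And>z. z \<in> S \<Longrightarrow> f z = 0"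
  shows "pderivs is f x = 0"
  using assms(2)
proof (induction "is" arbitrary: x)
  case (Cons i "is")
  have "pderivative i (pderivs is f) x = pderivative i (\<lambda>z. 0) x"
    by (rule pderivative_cong_on_open[OF assms(1) Cons.prems Cons.IH])
  then show ?case by (simp add: pderivative_def)
qed (use assms in simp)

text \<open>Constant coefficients commute with differentiation, so derivatives of the equation are again of
  the same form with shifted indices.\<close>

lemma derivative_of_pde:
  assumes S: "open S" "x \<in> S" and f: "C_class (mi_degree q + c) S f"
    and pde: "\<And>z. z \<in> S \<Longrightarrow> diff_op a c f z = 0"
  shows "(\<Sum>m\<in>mi_upto c. a m * mi_deriv (q + m) f x) = 0"
proof -
  have C: "C_class (mi_degree q + mi_degree m) S f" if "m \<in> mi_upto c" for m
    using C_class_mono[of "mi_degree q + mi_degree m" "c - mi_degree m" S f] f that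
    by (simp add: mi_upto_def)
  have Cm: "C_class (length (coord_word q)) S (mi_deriv m f)" if "m \<in> mi_upto c" for m
    using C[OF that] unfolding mi_deriv_eq_pderivs
    by (intro C_class_pderivs) (simp add: length_coord_word)
  have "(\<Sum>m\<in>mi_upto c. a m * mi_deriv (q + m) f x) =
      (\<Sum>m\<in>mi_upto c. a m * pderivs (coord_word q) (mi_deriv m f) x)"
    by (intro sum.cong refl arg_cong2[of _ _ _ _ "(*)"] mi_deriv_add[OF S C])
  also have "\<dots> = pderivs (coord_word q) (diff_op a c f) x"
    using pderivs_linear_combination[OF S(1) Cm S(2), of "mi_upto c" "\<lambda>m. m" a]
    unfolding diff_op_def by simp
  also have "\<dots> = 0"
    by (intro pderivs_zero[OF S] pde)
  finally show ?thesis .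
qed

section \<open>Translation of multi-index expansions\<close>

lemma binomial_expansion_div_fact:
  fixes u v :: "'a::field_char_0"
  shows "(u + v) ^ n / fact n = (\<Sum>k\<le>n. u ^ (n - k) / fact (n - k) * (v ^ k / fact k))"
proof -
  have "(v + u) ^ n / fact n = (\<Sum>k\<le>n. of_nat (n choose k) * v ^ k * u ^ (n - k) / fact n)"
    by (simp add: binomial_ring sum_divide_distrib)
  also have "\<dots> = (\<Sum>k\<le>n. u ^ (n - k) / fact (n - k) * (v ^ k / fact k))"
    by (intro sum.cong refl) (simp add: binomial_fact field_simps)
  finally show ?thesis by (simp add: add.commute)
qed

lemma bij_betw_vec_lambda_PiE:
  "bij_betw vec_lambda (PiE UNIV (\<lambda>j. {..q $ j})) {i :: 'n::finite multi_index. i \<le> q}"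
  by (rule bij_betwI[where g = vec_nth]) (auto simp: less_eq_vec_def)

lemma finite_mi_atMost: "finite {i :: 'n::finite multi_index. i \<le> q}"
  using bij_betw_finite[OF bij_betw_vec_lambda_PiE[of q]] by (simp add: finite_PiE)

lemma mi_binomial:
  fixes h w :: "real ^ 'n::finite"
  shows "mi_power (h + w) q / mi_fact q =
    (\<Sum>i | i \<le> q. mi_power h (q - i) / mi_fact (q - i) * (mi_power w i / mi_fact i))"
proof -
  let ?t = "\<lambda>j k. (h $ j) ^ (q $ j - k) / fact (q $ j - k) * ((w $ j) ^ k / fact k)"
  have "mi_power (h + w) q / mi_fact q = (\<Prod>j\<in>UNIV. \<Sum>k\<le>q $ j. ?t j k)"
    by (simp add: mi_power_def mi_fact_def prod_dividef[symmetric] binomial_expansion_div_fact)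
  also have "\<dots> = (\<Sum>g\<in>PiE UNIV (\<lambda>j. {..q $ j}). \<Prod>j\<in>UNIV. ?t j (g j))"
    by (rule prod_sum_PiE) auto
  also have "\<dots> = (\<Sum>g\<in>PiE UNIV (\<lambda>j. {..q $ j}). \<Prod>j\<in>UNIV. ?t j (vec_lambda g $ j))"
    by simp
  also have "\<dots> = (\<Sum>i | i \<le> q. \<Prod>j\<in>UNIV. ?t j (i $ j))"
    by (rule sum.reindex_bij_betw[OF bij_betw_vec_lambda_PiE])
  also have "\<dots> = (\<Sum>i | i \<le> q. mi_power h (q - i) / mi_fact (q - i) * (mi_power w i / mi_fact i))"
    by (simp add: mi_power_def mi_fact_def prod_dividef prod.distrib)
  finally show ?thesis .
qed

lemma mi_degree_mono: "q \<le> r \<Longrightarrow> mi_degree q \<le> mi_degree r"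
  by (auto simp: mi_degree_def less_eq_vec_def intro: sum_mono)

lemma mi_add_diff_inverse: "q \<le> r \<Longrightarrow> q + (r - q) = (r :: 'n::finite multi_index)"
  by (simp add: vec_eq_iff less_eq_vec_def)

lemma mi_le_add: "q \<le> q + (r :: 'n::finite multi_index)"
  by (simp add: less_eq_vec_def)

lemma finite_mi_upto: "finite (mi_upto p :: 'n::finite multi_index set)"
proof (rule finite_subset[OF _ finite_mi_atMost[of "\<chi> j. p"]], safe)
  fix q :: "'n multi_index" assume "q \<in> mi_upto p"
  then have "q $ j \<le> p" for j
    using member_le_sum[of j UNIV "\<lambda>j. q $ j"] by (simp add: mi_upto_def mi_degree_def)
  then show "q \<le> (\<chi> j. p)" by (simp add: less_eq_vec_def)
qed

text \<open>With \<open>i = r + m\<close> and \<open>n = r + m + q\<close> the double sum runs over pairs \<open>(q, m)\<close> with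
  \<open>mi_degree m = c\<close>. The bound on the degree of \<open>n\<close> then becomes a condition on \<open>q\<close> alone, so the
  sum over \<open>m\<close> is complete and is a derivative of the equation.\<close>

lemma translated_row_annihilated:
  fixes H D :: "'n::finite multi_index \<Rightarrow> complex"
  assumes homogeneous: "\<And>m. m \<in> mi_upto c \<Longrightarrow> mi_degree m \<noteq> c \<Longrightarrow> a m = 0"
    and r: "mi_degree r + c \<le> p"
    and pde: "\<And>q. mi_degree q + mi_degree r + c \<le> p \<Longrightarrow> (\<Sum>m\<in>mi_upto c. a m * D (r + q + m)) = 0"
  shows "(\<Sum>n\<in>mi_upto p. \<Sum>i | i \<le> n.
            H (n - i) * (if r \<le> i \<and> i - r \<in> mi_upto c then a (i - r) else 0) * D n) = 0"
proof -
  let ?f = "\<lambda>(n, i). H (n - i) * (if r \<le> i \<and> i - r \<in> mi_upto c then a (i - r) else 0) * D n"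
  let ?S = "SIGMA n:mi_upto p. {i. i \<le> n}"
  let ?T = "{(n, i). n \<in> mi_upto p \<and> i \<le> n \<and> r \<le> i \<and> mi_degree (i - r) = c}"
  let ?M = "{m :: 'n multi_index. mi_degree m = c}"
  let ?Q = "mi_upto (p - c - mi_degree r) :: 'n multi_index set"
  have M: "?M \<subseteq> mi_upto c" by (auto simp: mi_upto_def)
  have "(\<Sum>n\<in>mi_upto p. \<Sum>i | i \<le> n. ?f (n, i)) = sum ?f ?S"
    by (simp add: sum.Sigma finite_mi_upto finite_mi_atMost)
  also have "\<dots> = sum ?f ?T"
  proof (rule sum.mono_neutral_right)
    show "finite ?S" by (intro finite_SigmaI finite_mi_upto finite_mi_atMost)
    show "\<forall>z\<in>?S - ?T. ?f z = 0" by (auto split: if_splits dest: homogeneous)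
  qed auto
  also have "\<dots> = (\<Sum>(q, m)\<in>?Q \<times> ?M. H q * a m * D (r + q + m))"
  proof (rule sum.reindex_bij_witness[where i = "\<lambda>(q, m). (r + q + m, r + m)"
        and j = "\<lambda>(n, i). (n - i, i - r)"])
    fix z assume z: "z \<in> ?T"
    obtain n i where ni: "z = (n, i)" by (cases z)
    with z have *: "i \<le> n" "r \<le> i" "mi_degree (i - r) = c" "mi_degree n \<le> p"
      by (auto simp: mi_upto_def)
    have i: "r + (i - r) = i" and n: "i + (n - i) = n"
      using * by (auto intro: mi_add_diff_inverse)
    have n': "r + (n - i) + (i - r) = n"
      using i n by (metis add.assoc add.commute)
    have deg: "mi_degree n = mi_degree r + c + mi_degree (n - i)"
      using mi_degree_add[of r "i - r"] mi_degree_add[of i "n - i"] * i n by simp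
    show "(\<lambda>(q, m). (r + q + m, r + m)) ((\<lambda>(n, i). (n - i, i - r)) z) = z"
      using ni i n' by simp
    show "(\<lambda>(n, i). (n - i, i - r)) z \<in> ?Q \<times> ?M"
      using ni * deg by (auto simp: mi_upto_def)
    show "(case (\<lambda>(n, i). (n - i, i - r)) z of (q, m) \<Rightarrow> H q * a m * D (r + q + m)) = ?f z"
      using ni * n' by (auto simp: mi_upto_def)
  next
    fix z assume z: "z \<in> ?Q \<times> ?M"
    then obtain q m where qm: "z = (q, m)" "q \<in> ?Q" "mi_degree m = c" by auto
    have eq: "r + q + m - (r + m) = q" "r + m - r = m"
      by (simp_all add: vec_eq_iff)
    show "(\<lambda>(n, i). (n - i, i - r)) ((\<lambda>(q, m). (r + q + m, r + m)) z) = z"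
      using qm eq by simp
    show "(\<lambda>(q, m). (r + q + m, r + m)) z \<in> ?T"
      using qm eq r by (auto simp: mi_upto_def mi_degree_add less_eq_vec_def)
  qed
  also have "\<dots> = (\<Sum>q\<in>?Q. H q * (\<Sum>m\<in>?M. a m * D (r + q + m)))"
    by (simp add: sum.cartesian_product[symmetric] sum_distrib_left mult.assoc)
  also have "\<dots> = (\<Sum>q\<in>?Q. H q * (\<Sum>m\<in>mi_upto c. a m * D (r + q + m)))"
  proof -
    have "(\<Sum>m\<in>?M. a m * D (r + q + m)) = (\<Sum>m\<in>mi_upto c. a m * D (r + q + m))" for q
      by (rule sum.mono_neutral_left[OF finite_mi_upto M]) (auto dest: homogeneous)
    then show ?thesis by simp
  qed
  also have "\<dots> = 0"
    using r pde by (intro sum.neutral) (auto simp: mi_upto_def)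
  finally show ?thesis by simp
qed

section \<open>Graded monomial orderings\<close>

context
  fixes \<nu> :: "nat \<Rightarrow> 'n::finite multi_index"
  assumes ord: "graded_monomial_ordering \<nu>"
begin

lemma ordering_bij: "bij_betw \<nu> {1..} UNIV"
  using ord by (simp add: graded_monomial_ordering_def)

lemma ordering_index [simp]: "\<nu> (mi_index \<nu> q) = q"
  using bij_betw_inv_into_right[OF ordering_bij] by (simp add: mi_index_def)

lemma index_ordering [simp]: "i \<ge> 1 \<Longrightarrow> mi_index \<nu> (\<nu> i) = i"
  using bij_betw_inv_into_left[OF ordering_bij] by (simp add: mi_index_def)

lemma index_ge_1: "mi_index \<nu> q \<ge> 1"
  using inv_into_into[of q \<nu> "{1..}"] ordering_bij by (simp add: mi_index_def bij_betw_def)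

lemma index_eq_iff: "mi_index \<nu> q = mi_index \<nu> r \<longleftrightarrow> q = r"
  by (metis ordering_index)

lemma index_add_less: "mi_index \<nu> q < mi_index \<nu> r \<Longrightarrow> mi_index \<nu> (q + s) < mi_index \<nu> (r + s)"
  using ord index_ge_1[of q] index_ge_1[of r] index_ge_1[of s]
  unfolding graded_monomial_ordering_def by (metis ordering_index)

lemma degree_mono: "1 \<le> i \<Longrightarrow> i \<le> j \<Longrightarrow> mi_degree (\<nu> i) \<le> mi_degree (\<nu> j)"
  using ord unfolding graded_monomial_ordering_def by (meson leD le_trans not_le)

text \<open>The indices of the exponents of degree at most \<open>p\<close> form an initial segment because the ordering is
  graded, and a finite initial segment is determined by its cardinality.\<close>

lemma ordering_image: "\<nu> ` {1..mi_count TYPE('n) p} = mi_upto p"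
proof -
  let ?I = "mi_index \<nu> ` mi_upto p"
  have card: "card ?I = mi_count TYPE('n) p"
    by (subst card_image) (auto simp: mi_count_def inj_on_def index_eq_iff)
  have fin: "finite ?I" by (intro finite_imageI finite_mi_upto)
  have down: "i \<in> ?I" if "1 \<le> i" "i \<le> j" "j \<in> ?I" for i j
  proof -
    have "mi_degree (\<nu> i) \<le> p"
      using degree_mono[OF that(1,2)] that(3) by (auto simp: mi_upto_def)
    then show ?thesis
      using that(1) by (intro image_eqI[where x = "\<nu> i"]) (auto simp: mi_upto_def)
  qed
  have "?I = {1..mi_count TYPE('n) p}"
  proof (rule card_subset_eq)
    show "?I \<subseteq> {1..mi_count TYPE('n) p}"
    proof
      fix j assume j: "j \<in> ?I"
      then have "{1..j} \<subseteq> ?I" using down by auto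
      then have "card {1..j} \<le> card ?I" by (rule card_mono[OF fin])
      then have "j \<le> card ?I" by simp
      moreover have "1 \<le> j" using j index_ge_1 by auto
      ultimately show "j \<in> {1..mi_count TYPE('n) p}" using card by simp
    qed
  qed (simp_all add: card)
  then show ?thesis
    by (metis (no_types, lifting) image_cong image_ident image_image ordering_index)
qed

lemma ordering_bij_upto: "bij_betw \<nu> {1..mi_count TYPE('n) p} (mi_upto p)"
  by (rule bij_betw_subset[OF ordering_bij _ ordering_image]) auto

lemma index_mem_cols: "mi_degree q \<le> p \<Longrightarrow> mi_index \<nu> q \<in> {1..mi_count TYPE('n) p}"
  using ordering_image[of p] by (metis (mono_tags, lifting) CollectI atLeastAtMost_iff imageE index_ordering mi_upto_def)

lemma ordering_mem_upto: "i \<in> {1..mi_count TYPE('n) p} \<Longrightarrow> mi_degree (\<nu> i) \<le> p"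
  using ordering_image[of p] by (auto simp: mi_upto_def)

lemma sum_cols_below:
  assumes "mi_degree q \<le> p"
  shows "(\<Sum>i | i \<in> {1..mi_count TYPE('n) p} \<and> \<nu> i \<le> q. g (\<nu> i)) = (\<Sum>i | i \<le> q. g i)"
proof (rule sum.reindex_bij_betw, rule bij_betw_subset[OF ordering_bij])
  show "\<nu> ` {i \<in> {1..mi_count TYPE('n) p}. \<nu> i \<le> q} = {i. i \<le> q}"
  proof (safe intro!: equalityI)
    fix r assume "r \<le> q"
    then have "mi_degree r \<le> p" using assms mi_degree_mono by (metis le_trans)
    then show "r \<in> \<nu> ` {i \<in> {1..mi_count TYPE('n) p}. \<nu> i \<le> q}"
      using \<open>r \<le> q\<close> index_mem_cols by (intro image_eqI[where x = "mi_index \<nu> r"]) auto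
  qed
qed auto

lemma leading_exponent:
  assumes "has_order a c"
  obtains m where "m \<in> mi_upto c" "a m \<noteq> 0"
    "\<And>m'. m' \<in> mi_upto c \<Longrightarrow> a m' \<noteq> 0 \<Longrightarrow> mi_index \<nu> m' \<le> mi_index \<nu> m"
proof -
  let ?A = "{m \<in> mi_upto c. a m \<noteq> 0}"
  have fin: "finite (mi_index \<nu> ` ?A)" by (simp add: finite_mi_upto)
  have "?A \<noteq> {}" using assms by (auto simp: has_order_def mi_upto_def)
  then have "Max (mi_index \<nu> ` ?A) \<in> mi_index \<nu> ` ?A"
    using fin by (intro Max_in) auto
  then obtain m where m: "m \<in> ?A" "Max (mi_index \<nu> ` ?A) = mi_index \<nu> m" by auto
  show ?thesis
    using m Max_ge[OF fin] by (intro that[of m]) auto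
qed

text \<open>The nonzero entries of row \<open>i\<close> sit at the exponents \<open>\<nu> i + m'\<close> for \<open>m'\<close> in the support of \<open>a\<close>, and
  adding \<open>\<nu> i\<close> preserves which of them is last.\<close>

lemma last_col_eq:
  assumes m: "m \<in> mi_upto c" "a m \<noteq> 0"
    "\<And>m'. m' \<in> mi_upto c \<Longrightarrow> a m' \<noteq> 0 \<Longrightarrow> mi_index \<nu> m' \<le> mi_index \<nu> m"
    and "c \<le> p" "i \<in> P_rows TYPE('n) c p"
  shows "last_col a c p \<nu> i = mi_index \<nu> (\<nu> i + m)"
  unfolding last_col_def
proof (rule Max_eqI)
  have "mi_degree (\<nu> i) \<le> p - c"
    using assms(5) ordering_mem_upto by (auto simp: P_rows_def)
  then have "mi_degree (\<nu> i + m) \<le> p"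
    using m(1) \<open>c \<le> p\<close> by (auto simp: mi_degree_add mi_upto_def)
  then show "mi_index \<nu> (\<nu> i + m) \<in> {k \<in> P_cols TYPE('n) p. P_mat a c \<nu> i k \<noteq> 0}"
    using m index_mem_cols[of "\<nu> i + m" p] by (auto simp: P_cols_def P_mat_def mi_le_add)
next
  fix k assume k: "k \<in> {k \<in> P_cols TYPE('n) p. P_mat a c \<nu> i k \<noteq> 0}"
  then have *: "\<nu> i \<le> \<nu> k" "\<nu> k - \<nu> i \<in> mi_upto c" "a (\<nu> k - \<nu> i) \<noteq> 0" "k \<ge> 1"
    by (auto simp: P_mat_def P_cols_def split: if_splits)
  have "mi_index \<nu> (\<nu> k - \<nu> i) \<le> mi_index \<nu> m" using m(3) * by simp
  then have "mi_index \<nu> ((\<nu> k - \<nu> i) + \<nu> i) \<le> mi_index \<nu> (m + \<nu> i)"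
    using index_add_less[of "\<nu> k - \<nu> i" m "\<nu> i"] by (auto simp: le_less index_eq_iff)
  then show "k \<le> mi_index \<nu> (\<nu> i + m)"
    using * mi_add_diff_inverse[of "\<nu> i" "\<nu> k"] by (simp add: add.commute)
qed (simp add: P_cols_def)

end

section \<open>Invertibility of the pivot columns\<close>

text \<open>
  Block inversion: if a matrix with inverse \<open>B\<close> is bordered by a row \<open>v\<close>, a zero column and a
  corner \<open>d\<close>, then \<open>B\<close> is bordered by the row \<open>- v B / d\<close>, a zero column and the corner \<open>1 / d\<close>.
\<close>

lemma is_inverse_on_bordered:
  assumes B: "is_inverse_on R K A B" and fin: "finite R" "finite K"
    and new: "r \<notin> R" "k \<notin> K"
    and col: "\<And>r'. r' \<in> R \<Longrightarrow> A r' k = 0" and "A r k \<noteq> 0"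
  shows "\<exists>B'. is_inverse_on (insert r R) (insert k K) A B'"
proof -
  define S where "S r' = (\<Sum>l\<in>K. A r l * B l r')" for r'
  define B' where "B' k' r' =
      (if k' = k then (if r' = r then 1 else - S r') / A r k
       else if r' = r then 0 else B k' r')" for k' r'
  have nr: "r' \<noteq> r" if "r' \<in> R" for r' using that new by auto
  have nk: "k' \<noteq> k" if "k' \<in> K" for k' using that new by auto
  have AB: "(\<Sum>k\<in>K. A r1 k * B k r2) = (if r1 = r2 then 1 else 0)" if "r1 \<in> R" "r2 \<in> R" for r1 r2
    using B that by (simp add: is_inverse_on_def)
  have BA: "(\<Sum>r\<in>R. B k1 r * A r k2) = (if k1 = k2 then 1 else 0)" if "k1 \<in> K" "k2 \<in> K" for k1 k2
    using B that by (simp add: is_inverse_on_def)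
  have sumK: "(\<Sum>k'\<in>K. A r1 k' * B' k' r2) = (if r2 = r then 0 else \<Sum>k'\<in>K. A r1 k' * B k' r2)"
    for r1 r2
    by (auto simp: B'_def nk intro!: sum.neutral sum.cong)
  have sumR: "(\<Sum>r'\<in>R. B' k1 r' * A r' k2) =
     (if k1 = k then - (\<Sum>r'\<in>R. S r' * A r' k2) / A r k
      else \<Sum>r'\<in>R. B k1 r' * A r' k2)" for k1 k2
    by (auto simp: B'_def nr sum_divide_distrib sum_negf[symmetric] intro!: sum.cong)
  have elim: "(\<Sum>r'\<in>R. S r' * A r' k2) = A r k2" if "k2 \<in> K" for k2
  proof -
    have "(\<Sum>r'\<in>R. S r' * A r' k2) = (\<Sum>l\<in>K. A r l * (\<Sum>r'\<in>R. B l r' * A r' k2))"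
      unfolding S_def sum_distrib_right sum_distrib_left mult.assoc by (rule sum.swap)
    also have "\<dots> = (\<Sum>l\<in>K. if l = k2 then A r l else 0)"
      by (intro sum.cong refl) (simp add: BA that)
    finally show ?thesis using that fin by simp
  qed
  have "is_inverse_on (insert r R) (insert k K) A B'"
    unfolding is_inverse_on_def
  proof (intro conjI ballI)
    fix r1 r2 assume "r1 \<in> insert r R" "r2 \<in> insert r R"
    then show "(\<Sum>k'\<in>insert k K. A r1 k' * B' k' r2) = (if r1 = r2 then 1 else 0)"
      using new fin col AB \<open>A r k \<noteq> 0\<close> by (auto simp: sumK nr B'_def[of k] S_def)
  next
    fix k1 k2 assume "k1 \<in> insert k K" "k2 \<in> insert k K"
    then show "(\<Sum>r'\<in>insert r R. B' k1 r' * A r' k2) = (if k1 = k2 then 1 else 0)"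
      using new fin col BA elim \<open>A r k \<noteq> 0\<close> by (auto simp: sumR nk B'_def[of _ r])
  qed
  then show ?thesis by blast
qed

lemma lower_triangular_invertible:
  assumes "\<And>i. i \<in> {1..n} \<Longrightarrow> A i (h i) \<noteq> 0"
    and "\<And>i j. 1 \<le> i \<Longrightarrow> i < j \<Longrightarrow> j \<le> n \<Longrightarrow> A i (h j) = 0"
  shows "\<exists>B. is_inverse_on {1..n} (h ` {1..n}) A B"
  using assms
proof (induction n)
  case 0
  then show ?case by (simp add: is_inverse_on_def)
next
  case (Suc n)
  have "\<exists>B. is_inverse_on {1..n} (h ` {1..n}) A B"
    using Suc.prems by (intro Suc.IH) auto
  then obtain B where B: "is_inverse_on {1..n} (h ` {1..n}) A B" ..
  have "h (Suc n) \<notin> h ` {1..n}"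
  proof
    assume "h (Suc n) \<in> h ` {1..n}"
    then obtain i where i: "i \<in> {1..n}" "h (Suc n) = h i" by auto
    then show False using Suc.prems(1)[of i] Suc.prems(2)[of i "Suc n"] by auto
  qed
  then have "\<exists>B'. is_inverse_on (insert (Suc n) {1..n}) (insert (h (Suc n)) (h ` {1..n})) A B'"
    using Suc.prems by (intro is_inverse_on_bordered[OF B]) auto
  moreover have "insert (Suc n) {1..n} = {1..Suc n}" by auto
  ultimately show ?case by (metis image_insert)
qed

text \<open>Since the pivot positions are \<open>\<nu> i + m\<close> for one leading exponent \<open>m\<close>, they increase
  strictly with the row; a row vanishes to the right of its own pivot, hence at the pivots of all
  later rows.\<close>

lemma P_mat_pivot_columns:
  fixes \<nu> :: "nat \<Rightarrow> 'n::finite multi_index"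
  assumes ord: "graded_monomial_ordering \<nu>" and "has_order a c" "c \<le> p"
  shows "J_bar a c p \<nu> \<subseteq> P_cols TYPE('n) p"
    and "is_inverse_on (P_rows TYPE('n) c p) (J_bar a c p \<nu>) (P_mat a c \<nu>)
           (inverse_on (P_rows TYPE('n) c p) (J_bar a c p \<nu>) (P_mat a c \<nu>))"
proof -
  let ?h = "last_col a c p \<nu>"
  obtain m where m: "m \<in> mi_upto c" "a m \<noteq> 0"
    "\<And>m'. m' \<in> mi_upto c \<Longrightarrow> a m' \<noteq> 0 \<Longrightarrow> mi_index \<nu> m' \<le> mi_index \<nu> m"
    using leading_exponent[OF ord \<open>has_order a c\<close>] by metis
  have h: "?h i = mi_index \<nu> (\<nu> i + m)" if "i \<in> P_rows TYPE('n) c p" for i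
    using m(3) \<open>c \<le> p\<close> that by (intro last_col_eq[where a = a and m = m, OF ord m(1,2)]) auto
  have in_cols: "?h i \<in> P_cols TYPE('n) p" if i: "i \<in> P_rows TYPE('n) c p" for i
  proof -
    have "mi_degree (\<nu> i) \<le> p - c"
      using i ordering_mem_upto[OF ord] by (auto simp: P_rows_def)
    then have "mi_degree (\<nu> i + m) \<le> p"
      using m(1) \<open>c \<le> p\<close> by (auto simp: mi_degree_add mi_upto_def)
    then show ?thesis
      using h[OF i] index_mem_cols[OF ord] by (simp add: P_cols_def)
  qed
  then show "J_bar a c p \<nu> \<subseteq> P_cols TYPE('n) p"
    by (auto simp: J_bar_def)
  have "\<exists>B. is_inverse_on (P_rows TYPE('n) c p) (J_bar a c p \<nu>) (P_mat a c \<nu>) B"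
    unfolding J_bar_def P_rows_def
  proof (rule lower_triangular_invertible)
    fix i assume "i \<in> {1..mi_count TYPE('n) (p - c)}"
    then have "?h i = mi_index \<nu> (\<nu> i + m)" by (intro h) (simp add: P_rows_def)
    then show "P_mat a c \<nu> i (?h i) \<noteq> 0"
      using m by (simp add: P_mat_def ordering_index[OF ord] mi_le_add)
  next
    fix i j assume ij: "1 \<le> i" "i < j" "j \<le> mi_count TYPE('n) (p - c)"
    then have rows: "i \<in> P_rows TYPE('n) c p" "j \<in> P_rows TYPE('n) c p"
      by (auto simp: P_rows_def)
    have "?h i < ?h j"
      using index_add_less[OF ord, of "\<nu> i" "\<nu> j" m] ij rows
      by (simp add: h index_ordering[OF ord])
    show "P_mat a c \<nu> i (?h j) = 0"
    proof (rule ccontr)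
      assume "P_mat a c \<nu> i (?h j) \<noteq> 0"
      then have "?h j \<le> ?h i"
        using in_cols[OF rows(2)] unfolding last_col_def[of a c p \<nu> i]
        by (intro Max_ge) (auto simp: P_cols_def)
      with \<open>?h i < ?h j\<close> show False by simp
    qed
  qed
  then show "is_inverse_on (P_rows TYPE('n) c p) (J_bar a c p \<nu>) (P_mat a c \<nu>)
           (inverse_on (P_rows TYPE('n) c p) (J_bar a c p \<nu>) (P_mat a c \<nu>))"
    unfolding inverse_on_def by (rule someI_ex)
qed

section \<open>Compression and translation\<close>

text \<open>
  On the pivot columns \<open>E\<beta>\<close> vanishes, which forces the weights \<open>w\<close> to reproduce \<open>\<alpha>\<close> there; the
  remaining columns then match because the decompression matrix is built from the same inverse.
\<close>

lemma compression_residual_in_row_space: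
  fixes \<nu> :: "nat \<Rightarrow> 'n::finite multi_index"
  assumes ord: "graded_monomial_ordering \<nu>" and "has_order a c" "c \<le> p"
    and \<beta>: "\<forall>i\<in>J_set a c p \<nu>. \<beta> i = compressed_coeff a c p \<nu> y z i"
  obtains w where "\<And>k. k \<in> P_cols TYPE('n) p \<Longrightarrow>
    of_real (multipole_coeff \<nu> y z k) - embed_coeff (J_set a c p \<nu>) \<beta> k =
      (\<Sum>r\<in>P_rows TYPE('n) c p. w r * P_mat a c \<nu> r k)"
proof -
  let ?C = "P_cols TYPE('n) p" and ?R = "P_rows TYPE('n) c p"
  let ?K = "J_bar a c p \<nu>" and ?J = "J_set a c p \<nu>" and ?P = "P_mat a c \<nu>"
  let ?\<alpha> = "\<lambda>k. complex_of_real (multipole_coeff \<nu> y z k)"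
  define B where "B = inverse_on ?R ?K ?P"
  have K: "?K \<subseteq> ?C" and B: "is_inverse_on ?R ?K ?P B"
    using P_mat_pivot_columns[OF assms(1-3)] by (simp_all add: B_def)
  have fin: "finite ?C" "finite ?K" "finite ?J"
    using finite_subset[OF K] by (auto simp: P_cols_def J_set_def)
  define w where "w r = (\<Sum>k\<in>?K. B k r * ?\<alpha> k)" for r
  have swap: "(\<Sum>r\<in>?R. w r * ?P r l) = (\<Sum>k\<in>?K. (\<Sum>r\<in>?R. B k r * ?P r l) * ?\<alpha> k)" for l
    unfolding w_def sum_distrib_right by (subst sum.swap) (simp add: mult_ac)
  show ?thesis
  proof (rule that[of w])
    fix l assume l: "l \<in> ?C"
    show "?\<alpha> l - embed_coeff ?J \<beta> l = (\<Sum>r\<in>?R. w r * ?P r l)"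
    proof (cases "l \<in> ?J")
      case True
      have "compressed_coeff a c p \<nu> y z l =
          (\<Sum>k\<in>?J. decompression a c p \<nu> k l * ?\<alpha> k) + (\<Sum>k\<in>?K. decompression a c p \<nu> k l * ?\<alpha> k)"
        using sum.subset_diff[OF K fin(1), of "\<lambda>k. decompression a c p \<nu> k l * ?\<alpha> k"]
        by (simp add: compressed_coeff_def J_set_def)
      also have "(\<Sum>k\<in>?J. decompression a c p \<nu> k l * ?\<alpha> k) = (\<Sum>k\<in>?J. if k = l then ?\<alpha> k else 0)"
        by (intro sum.cong refl) (simp add: decompression_def)
      also have "\<dots> = ?\<alpha> l" using True fin by simp
      also have "(\<Sum>k\<in>?K. decompression a c p \<nu> k l * ?\<alpha> k) = - (\<Sum>r\<in>?R. w r * ?P r l)"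
        unfolding swap sum_negf[symmetric]
        by (intro sum.cong refl) (auto simp: decompression_def J_set_def B_def)
      finally show ?thesis using True \<beta> by (simp add: embed_coeff_def)
    next
      case False
      then have "l \<in> ?K" using l by (simp add: J_set_def)
      have "(\<Sum>r\<in>?R. w r * ?P r l) = (\<Sum>k\<in>?K. if k = l then ?\<alpha> k else 0)"
        unfolding swap using B \<open>l \<in> ?K\<close>
        by (intro sum.cong refl) (simp add: is_inverse_on_def)
      also have "\<dots> = ?\<alpha> l" using \<open>l \<in> ?K\<close> fin by simp
      finally show ?thesis using False by (simp add: embed_coeff_def)
    qed
  qed
qed

theorem theorem17:
  fixes a :: "('n::finite) multi_index \<Rightarrow> complex"
    and c p :: nat
    and G :: "real ^ 'n \<Rightarrow> complex"
    and \<nu> :: "nat \<Rightarrow> 'n multi_index"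
    and y c1 c2 h :: "real ^ 'n"
    and \<beta> \<rho> \<sigma> :: "nat \<Rightarrow> complex"
  assumes "c \<ge> 1" and "p \<ge> c"
    and "has_order a c"
    and "\<forall>m\<in>mi_upto c. mi_degree m \<noteq> c \<longrightarrow> a m = 0"
    and "graded_monomial_ordering \<nu>"
    and "C_class (2 * p) (UNIV - {0}) G"
    and "\<forall>x. x \<noteq> 0 \<longrightarrow> diff_op a c G x = 0"
    and "h = c2 - c1"
    and "\<forall>i\<in>J_set a c p \<nu>. \<beta> i = compressed_coeff a c p \<nu> y c1 i"
    and "\<forall>n\<in>{1..mi_count TYPE('n) p}.
           \<rho> n = of_real (mi_power (c2 - y) (\<nu> n) / mi_fact (\<nu> n))"
    and "\<forall>n\<in>{1..mi_count TYPE('n) p}.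
           \<sigma> n = (\<Sum>i | i \<in> {1..mi_count TYPE('n) p} \<and> \<nu> i \<le> \<nu> n.
             of_real (mi_power h (\<nu> n - \<nu> i) / mi_fact (\<nu> n - \<nu> i)) * embed_coeff (J_set a c p \<nu>) \<beta> i)"
  shows "\<forall>x. x \<noteq> c2 \<longrightarrow>
    (\<Sum>n=1..mi_count TYPE('n) p. \<sigma> n * mi_deriv (\<nu> n) G (x - c2)) =
    (\<Sum>n=1..mi_count TYPE('n) p. \<rho> n * mi_deriv (\<nu> n) G (x - c2))"
proof (intro allI impI)
  fix x assume "x \<noteq> c2"
  note ord = \<open>graded_monomial_ordering \<nu>\<close>
  let ?C = "{1..mi_count TYPE('n) p}" and ?R = "P_rows TYPE('n) c p" and ?P = "P_mat a c \<nu>"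
  define D where "D q = mi_deriv q G (x - c2)" for q
  define H where "H q = complex_of_real (mi_power h q / mi_fact q)" for q
  define \<alpha> where "\<alpha> q = complex_of_real (mi_power (c1 - y) q / mi_fact q)" for q
  obtain w where w: "\<And>k. k \<in> ?C \<Longrightarrow>
    \<alpha> (\<nu> k) - embed_coeff (J_set a c p \<nu>) \<beta> k = (\<Sum>r\<in>?R. w r * ?P r k)"
    using compression_residual_in_row_space[OF ord assms(3,2,9)]
    unfolding P_cols_def multipole_coeff_def \<alpha>_def by metis
  have diff: "\<rho> n - \<sigma> n = (\<Sum>i | i \<in> ?C \<and> \<nu> i \<le> \<nu> n. H (\<nu> n - \<nu> i) * (\<Sum>r\<in>?R. w r * ?P r i))"
    if n: "n \<in> ?C" for n
  proof -
    have c2: "c2 - y = h + (c1 - y)" using assms(8) by simp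
    have "\<rho> n = of_real (mi_power (h + (c1 - y)) (\<nu> n) / mi_fact (\<nu> n))"
      using assms(10) n unfolding c2 by blast
    also have "\<dots> = (\<Sum>i | i \<le> \<nu> n. H (\<nu> n - i) * \<alpha> i)"
      unfolding mi_binomial by (simp add: H_def \<alpha>_def)
    also have "\<dots> = (\<Sum>i | i \<in> ?C \<and> \<nu> i \<le> \<nu> n. H (\<nu> n - \<nu> i) * \<alpha> (\<nu> i))"
      using sum_cols_below[OF ord ordering_mem_upto[OF ord n], of "\<lambda>i. H (\<nu> n - i) * \<alpha> i"] by simp
    finally have "\<rho> n - \<sigma> n = (\<Sum>i | i \<in> ?C \<and> \<nu> i \<le> \<nu> n.
        H (\<nu> n - \<nu> i) * (\<alpha> (\<nu> i) - embed_coeff (J_set a c p \<nu>) \<beta> i))"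
      using assms(11) n by (simp add: H_def right_diff_distrib sum_subtractf)
    also have "\<dots> = (\<Sum>i | i \<in> ?C \<and> \<nu> i \<le> \<nu> n. H (\<nu> n - \<nu> i) * (\<Sum>r\<in>?R. w r * ?P r i))"
      by (intro sum.cong refl) (simp add: w)
    finally show ?thesis .
  qed
  have row: "(\<Sum>n\<in>?C. \<Sum>i | i \<in> ?C \<and> \<nu> i \<le> \<nu> n. H (\<nu> n - \<nu> i) * ?P r i * D (\<nu> n)) = 0"
    if r: "r \<in> ?R" for r
  proof -
    let ?b = "\<lambda>i. if \<nu> r \<le> i \<and> i - \<nu> r \<in> mi_upto c then a (i - \<nu> r) else 0"
    have deg_r: "mi_degree (\<nu> r) + c \<le> p"
      using r ordering_mem_upto[OF ord, of r "p - c"] assms(2) by (simp add: P_rows_def)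
    have "(\<Sum>n\<in>?C. \<Sum>i | i \<in> ?C \<and> \<nu> i \<le> \<nu> n. H (\<nu> n - \<nu> i) * ?P r i * D (\<nu> n)) =
        (\<Sum>n\<in>?C. \<Sum>i | i \<le> \<nu> n. H (\<nu> n - i) * ?b i * D (\<nu> n))"
    proof (intro sum.cong refl)
      fix n assume n: "n \<in> ?C"
      show "(\<Sum>i | i \<in> ?C \<and> \<nu> i \<le> \<nu> n. H (\<nu> n - \<nu> i) * ?P r i * D (\<nu> n)) =
        (\<Sum>i | i \<le> \<nu> n. H (\<nu> n - i) * ?b i * D (\<nu> n))"
        using sum_cols_below[OF ord ordering_mem_upto[OF ord n],
            of "\<lambda>i. H (\<nu> n - i) * ?b i * D (\<nu> n)"]
        unfolding P_mat_def .
    qed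
    also have "\<dots> = (\<Sum>n\<in>mi_upto p. \<Sum>i | i \<le> n. H (n - i) * ?b i * D n)"
      by (rule sum.reindex_bij_betw[OF ordering_bij_upto[OF ord]])
    also have "\<dots> = 0"
    proof (rule translated_row_annihilated[OF _ deg_r])
      fix q :: "'n multi_index" assume q: "mi_degree q + mi_degree (\<nu> r) + c \<le> p"
      have "C_class (mi_degree (\<nu> r + q) + c) (UNIV - {0}) G"
        using C_class_mono[of "mi_degree (\<nu> r + q) + c" "2 * p - (mi_degree (\<nu> r + q) + c)"]
          q assms(6) by (simp add: mi_degree_add)
      then show "(\<Sum>m\<in>mi_upto c. a m * D (\<nu> r + q + m)) = 0"
        unfolding D_def using \<open>x \<noteq> c2\<close> assms(7)
        by (intro derivative_of_pde[where S = "UNIV - {0}"]) (auto intro: open_delete)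
    qed (use assms(4) in auto)
    finally show ?thesis .
  qed
  have "(\<Sum>n\<in>?C. (\<rho> n - \<sigma> n) * D (\<nu> n)) =
      (\<Sum>n\<in>?C. \<Sum>i | i \<in> ?C \<and> \<nu> i \<le> \<nu> n. \<Sum>r\<in>?R. w r * (H (\<nu> n - \<nu> i) * ?P r i * D (\<nu> n)))"
    by (intro sum.cong refl) (simp add: diff sum_distrib_left sum_distrib_right mult_ac)
  also have "\<dots> = (\<Sum>n\<in>?C. \<Sum>r\<in>?R. \<Sum>i | i \<in> ?C \<and> \<nu> i \<le> \<nu> n. w r * (H (\<nu> n - \<nu> i) * ?P r i * D (\<nu> n)))"
    by (intro sum.cong refl sum.swap)
  also have "\<dots> = (\<Sum>r\<in>?R. w r * (\<Sum>n\<in>?C. \<Sum>i | i \<in> ?C \<and> \<nu> i \<le> \<nu> n. H (\<nu> n - \<nu> i) * ?P r i * D (\<nu> n)))"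
    by (subst sum.swap) (simp add: sum_distrib_left)
  also have "\<dots> = 0"
  proof (rule sum.neutral, rule ballI)
    fix r assume "r \<in> ?R"
    from row[OF this] show "w r * (\<Sum>n\<in>?C. \<Sum>i | i \<in> ?C \<and> \<nu> i \<le> \<nu> n. H (\<nu> n - \<nu> i) * ?P r i * D (\<nu> n)) = 0"
      by (simp only: mult_zero_right)
  qed
  finally show "(\<Sum>n=1..mi_count TYPE('n) p. \<sigma> n * mi_deriv (\<nu> n) G (x - c2)) =
    (\<Sum>n=1..mi_count TYPE('n) p. \<rho> n * mi_deriv (\<nu> n) G (x - c2))"
    by (simp add: D_def left_diff_distrib sum_subtractf)
qed

end
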